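(* Let $\alpha \geq 1$ be a real number and let $S$ be an infinite set of positive integers of polynomial density $\alpha$. Let $P(S)$ be the set of primes dividing at least one element of $S$, and let $\pi_S(n) = \operatorname{card}\{p \in P(S) : p \leq n\}$. Then: (a) $\displaystyle\sum_{p \in P(S)} p^{-1/\alpha} = \infty$. (b) $\displaystyle\sum_{n=1}^\infty \frac{\pi_S(n)}{n^{1+1/\alpha}} = \infty$. (c) If $(a_n)_{n=1}^\infty$ is a sequence of real numbers with $a_n > 0$ for all $n$ and $\sum_{n=1}^\infty a_n < \infty$, then $\displaystyle\frac{\pi_S(n)}{n^{1+1/\alpha}} \geq a_n$ for infinitely many positive integers $n$.
   Context: For real $\alpha \geq 1$ (not necessarily an integer), an infinite set $S$ of positive integers is said to have polynomial density $\alpha$ if $S$ is the range of a strictly increasing sequence $(s_n)_{n=1}^\infty$ of positive integers such that $s_n = O(n^\alpha)$, i.e. there is a constant $C > 0$ with $s_n \leq C n^\alpha$ for all $n \geq 1$. (Only this upper bound is required.) The set of prime factors of elements of $S$ is $$P(S) = \{p : p \text{ is prime and } p \mid s \text{ for at least one } s \in S\}.$$ *)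

theory Defs
  imports "HOL-Analysis.Analysis" "HOL-Computational_Algebra.Primes"
begin

text \<open>Sequences are indexed from 1, so their values at 0 are irrelevant.\<close>

definition has_poly_density :: "real \<Rightarrow> nat set \<Rightarrow> bool" where
  "has_poly_density \<alpha> S \<longleftrightarrow>
     (\<exists>s :: nat \<Rightarrow> nat. strict_mono_on {1..} s \<and> (\<forall>n\<ge>1. s n > 0) \<and> S = s ` {1..} \<and>
        (\<exists>C>0. \<forall>n\<ge>1. real (s n) \<le> C * real n powr \<alpha>))"

definition prime_divisors_of_set :: "nat set \<Rightarrow> nat set" where
  "prime_divisors_of_set S = {p. prime p \<and> (\<exists>s\<in>S. p dvd s)}"

definition prime_count :: "nat set \<Rightarrow> nat \<Rightarrow> nat" where
  "prime_count S n = card {p \<in> prime_divisors_of_set S. p \<le> n}"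

end

theory Submission
  imports Defs
begin

text \<open>
  Put \<open>\<beta> = 1 / \<alpha>\<close>. Since \<open>s\<^sub>n\<^sup>-\<^sup>\<beta> \<ge> C\<^sup>-\<^sup>\<beta> / n\<close>, the sum of \<open>s\<^sup>-\<^sup>\<beta>\<close> over \<open>S\<close> diverges. It is at most the
  Euler product of \<open>1 / (1 - p\<^sup>-\<^sup>\<beta>)\<close> over \<open>P(S)\<close>, whose divergence forces (a). As the terms
  \<open>n\<^sup>-\<^sup>1\<^sup>-\<^sup>\<beta>\<close> with \<open>p \<le> n < 2 p\<close> add up to at least \<open>2\<^sup>-\<^sup>1\<^sup>-\<^sup>\<beta> p\<^sup>-\<^sup>\<beta>\<close>, exchanging the order of summation
  deduces (b) from (a), and (c) follows from (b) by comparison.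
\<close>

text \<open>Induction on \<open>F\<close>: removing the full power of the new prime \<open>p\<close>
  from \<open>n\<close> leaves an integer with all prime factors in the old \<open>F\<close>. Since
  \<open>n powr (-b)\<close> is completely multiplicative, a geometric sum in \<open>p\<close>
  splits off. Finite \<open>A\<close> keeps every sum finite.\<close>

lemma sum_powr_le_euler_product:
  fixes b :: real
  assumes "b > 0" "finite F" "finite A" "\<And>p. p \<in> F \<Longrightarrow> prime p"
    and "\<And>n. n \<in> A \<Longrightarrow> n > 0 \<and> prime_factors n \<subseteq> F"
  shows "(\<Sum>n\<in>A. real n powr (-b)) \<le> (\<Prod>p\<in>F. 1 / (1 - real p powr (-b)))"
  using assms(2,3,4,5)
proof (induction F arbitrary: A)
  case empty
  \<comment> \<open>With no primes available only 1 can lie in \<open>A\<close>, matching the empty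
    product 1.\<close>
  have "n = 1" if "n \<in> A" for n
    using empty.prems(3)[OF that] prime_factorization_empty_iff[of n] by auto
  then have "A \<subseteq> {1}" by auto
  then have "(\<Sum>n\<in>A. real n powr (-b)) \<le> (\<Sum>n\<in>{1}. real n powr (-b))"
    by (intro sum_mono2) auto
  then show ?case by simp
next
  case (insert p F)
  let ?w = "\<lambda>n. real n powr (-b)"
  let ?h = "\<lambda>n. (multiplicity p n, n div p ^ multiplicity p n)"
  define B where "B = (\<lambda>n. n div p ^ multiplicity p n) ` A"
  \<comment> \<open>\<open>N\<close> bounds all exponents of \<open>p\<close> occurring in
    \<open>A\<close>; inserting 0 keeps \<open>Max\<close> meaningful for empty
    \<open>A\<close>.\<close>
  define N where "N = Max (insert 0 (multiplicity p ` A))"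
  have p: "prime p" and p1: "p > 1" using insert.prems(2) prime_gt_1_nat by auto
  have finB: "finite B" using insert.prems unfolding B_def by auto
  have split_n: "n = p ^ multiplicity p n * (n div p ^ multiplicity p n)" for n
    by (simp add: multiplicity_dvd)
  have B: "m > 0 \<and> prime_factors m \<subseteq> F" if "m \<in> B" for m
  proof -
    obtain n where n: "n \<in> A" "m = n div p ^ multiplicity p n"
      using \<open>m \<in> B\<close> unfolding B_def by auto
    have n0: "n > 0" "prime_factors n \<subseteq> insert p F" using insert.prems(3)[OF n(1)] by auto
    have nm: "n = p ^ multiplicity p n * m" using split_n n(2) by simp
    have m0: "m > 0" using n0 nm by (metis gr0I mult_0_right)
    have "\<not> p dvd m"
      using multiplicity_decompose[of n p] n0 p1 n(2) by auto
    moreover have "prime_factors m \<subseteq> prime_factors n"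
      using n0 m0 nm by (metis dvd_prime_factors dvd_triv_right less_not_refl)
    ultimately show ?thesis using n0 m0 by (auto simp: prime_factors_dvd)
  qed
  have inj: "inj_on ?h A"
    by (rule inj_onI) (metis Pair_inject split_n)
  have x: "0 \<le> ?w p" "?w p < 1"
    using p1 \<open>b > 0\<close> by (auto simp: powr_less_one)
  have w: "?w n = ?w p ^ multiplicity p n * ?w (n div p ^ multiplicity p n)" for n
    using p1 arg_cong[OF split_n[of n], of ?w]
    by (simp add: powr_mult powr_power powr_realpow[symmetric] powr_powr mult.commute)
  have "(\<Sum>n\<in>A. ?w n) = (\<Sum>n\<in>A. (\<lambda>(k, m). ?w p ^ k * ?w m) (?h n))"
    by (intro sum.cong refl) (simp only: prod.case w[symmetric])
  also have "\<dots> = (\<Sum>(k, m)\<in>?h ` A. ?w p ^ k * ?w m)"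
    by (subst sum.reindex[OF inj]) (simp add: o_def)
  \<comment> \<open>Enlarging the image of \<open>A\<close> to a full box adds only nonnegative
    terms and makes the sum factor.\<close>
  also have "\<dots> \<le> (\<Sum>(k, m)\<in>{..N} \<times> B. ?w p ^ k * ?w m)"
  proof (intro sum_mono2)
    show "?h ` A \<subseteq> {..N} \<times> B"
      using insert.prems(1) unfolding N_def B_def by auto
  qed (auto simp: finB)
  also have "\<dots> = (\<Sum>k\<le>N. ?w p ^ k) * (\<Sum>m\<in>B. ?w m)"
    by (simp add: sum_product sum.cartesian_product)
  also have "\<dots> \<le> 1 / (1 - ?w p) * (\<Prod>q\<in>F. 1 / (1 - ?w q))"
  proof (intro mult_mono)
    have "(\<Sum>k\<le>N. ?w p ^ k) \<le> (\<Sum>k. ?w p ^ k)"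
      using x by (intro sum_le_suminf summable_geometric) auto
    then show "(\<Sum>k\<le>N. ?w p ^ k) \<le> 1 / (1 - ?w p)"
      using x by (simp add: suminf_geometric)
    show "(\<Sum>m\<in>B. ?w m) \<le> (\<Prod>q\<in>F. 1 / (1 - ?w q))"
      using insert.IH[OF finB _ B] insert.prems(2) by simp
  qed (use x in \<open>auto intro: sum_nonneg\<close>)
  finally show ?case using insert.hyps by simp
qed

text \<open>Each factor is \<open>1 + x / (1 - x)\<close> with \<open>x = p powr (-b)\<close>. As
  \<open>p \<ge> 2\<close>, the denominator is at least \<open>1 - 2 powr (-b)\<close>, uniformly in
  \<open>p\<close>; then \<open>1 + y \<le> exp y\<close> turns the product into a sum.\<close>

lemma euler_product_le_exp:
  fixes b :: real
  assumes "b > 0" "finite F" "\<And>p. p \<in> F \<Longrightarrow> prime (p::nat)"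
  shows "(\<Prod>p\<in>F. 1 / (1 - real p powr (-b)))
    \<le> exp ((\<Sum>p\<in>F. real p powr (-b)) / (1 - 2 powr (-b)))"
proof -
  have t: "(2::real) powr (-b) < 1" using assms(1) by (auto simp: powr_less_one)
  have "0 \<le> 1 / (1 - x) \<and> 1 / (1 - x) \<le> exp (x / (1 - 2 powr (-b)))"
    if "p \<in> F" "x = real p powr (-b)" for p x
  proof -
    have "2 \<le> real p" using prime_ge_2_nat[OF assms(3)[OF that(1)]] by simp
    then have x: "0 \<le> x" "x \<le> 2 powr (-b)"
      using assms(1) that(2) by (auto intro: powr_mono2')
    have "1 / (1 - x) = 1 + x / (1 - x)" using x t by (simp add: field_simps)
    also have "\<dots> \<le> 1 + x / (1 - 2 powr (-b))"
      using x t by (intro add_left_mono divide_left_mono) auto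
    also have "\<dots> \<le> exp (x / (1 - 2 powr (-b)))" by (rule exp_ge_add_one_self)
    finally show ?thesis using x t by auto
  qed
  then show ?thesis
    using assms(2) by (auto simp: sum_divide_distrib exp_sum intro: prod_mono)
qed

text \<open>Part (a) in finitary form, from which both the infinite sum over primes and the series
  in (b) are treated.\<close>

lemma prime_powr_sums_unbounded:
  assumes "\<alpha> \<ge> 1" "has_poly_density \<alpha> S"
  obtains F where "finite F" "F \<subseteq> prime_divisors_of_set S"
    "(\<Sum>p\<in>F. real p powr (- (1 / \<alpha>))) > K"
proof (rule ccontr)
  assume "\<not> thesis"
  with that have K: "(\<Sum>p\<in>F. real p powr (- (1 / \<alpha>))) \<le> K"
    if "finite F" "F \<subseteq> prime_divisors_of_set S" for F
    using \<open>finite F\<close> \<open>F \<subseteq> _\<close> by fastforce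
  define b where "b = 1 / \<alpha>"
  have b: "b > 0" "\<alpha> * b = 1" using assms(1) by (auto simp: b_def)
  obtain s C where s: "strict_mono_on {1..} s" "\<And>n. n \<ge> 1 \<Longrightarrow> s n > 0" "S = s ` {1..}"
    and C: "C > 0" "\<And>n. n \<ge> 1 \<Longrightarrow> real (s n) \<le> C * real n powr \<alpha>"
    using assms(2) unfolding has_poly_density_def by auto
  \<comment> \<open>The Euler product bound when all finite prime sums are at most \<open>K\<close>;
    it does not depend on how many \<open>s n\<close> are used.\<close>
  define E where "E = exp (K / (1 - 2 powr (-b)))"
  have bound: "(\<Sum>n\<in>{1..N}. real (s n) powr (-b)) \<le> E" for N
  proof -
    define F where "F = (\<Union>n\<in>{1..N}. prime_factors (s n))"
    have F: "finite F" "F \<subseteq> prime_divisors_of_set S" "\<And>p. p \<in> F \<Longrightarrow> prime p"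
      using s(3) unfolding F_def prime_divisors_of_set_def by (auto dest: in_prime_factors_imp_dvd)
    \<comment> \<open>Distinct indices give distinct integers, so the sum over indices is a sum over
      a set, as the Euler product bound requires.\<close>
    have inj: "inj_on s {1..N}"
      by (rule inj_on_subset[OF strict_mono_on_imp_inj_on[OF s(1)]]) auto
    have "(\<Sum>n\<in>{1..N}. real (s n) powr (-b)) = (\<Sum>m\<in>s ` {1..N}. real m powr (-b))"
      by (simp only: sum.reindex[OF inj] o_def)
    also have "\<dots> \<le> (\<Prod>p\<in>F. 1 / (1 - real p powr (-b)))"
      using s(2) by (intro sum_powr_le_euler_product b F) (auto simp: F_def)
    also have "\<dots> \<le> exp ((\<Sum>p\<in>F. real p powr (-b)) / (1 - 2 powr (-b)))"
      by (intro euler_product_le_exp b F)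
    also have "\<dots> \<le> E"
      using K[OF F(1,2)] b(1) unfolding E_def b_def[symmetric]
      by (auto intro!: divide_right_mono simp: powr_less_one less_imp_le)
    finally show ?thesis .
  qed
  \<comment> \<open>The growth bound enters here: \<open>x powr (-b)\<close> is decreasing, and
    \<open>\<alpha> * b = 1\<close> turns \<open>n powr \<alpha>\<close> into
    \<open>1 / n\<close>.\<close>
  have recip_le: "C powr (-b) * (1 / real n) \<le> real (s n) powr (-b)" if "n \<ge> 1" for n
  proof -
    have "C powr (-b) * (1 / real n) = (C * real n powr \<alpha>) powr (-b)"
      using that C(1) b by (simp add: powr_mult powr_powr powr_minus_divide)
    also have "\<dots> \<le> real (s n) powr (-b)"
      using C(2)[OF that] s(2)[OF that] b by (intro powr_mono2') auto
    finally show ?thesis .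
  qed
  have "(\<Sum>n<N. 1 / real (Suc n)) \<le> E / C powr (-b)" for N
  proof -
    have "C powr (-b) * (\<Sum>n<N. 1 / real (Suc n)) = (\<Sum>n\<in>{1..N}. C powr (-b) * (1 / real n))"
      by (simp add: sum_distrib_left sum.atLeast1_atMost_eq)
    also have "\<dots> \<le> (\<Sum>n\<in>{1..N}. real (s n) powr (-b))"
      by (intro sum_mono recip_le) auto
    also have "\<dots> \<le> E" by (rule bound)
    finally show ?thesis using C(1) by (simp add: field_simps)
  qed
  then have "summable (\<lambda>n. 1 / real (Suc n))"
    by (intro bounded_imp_summable[of _ "E / C powr (-b)"])
       (simp_all only: lessThan_Suc_atMost[symmetric], simp)
  then show False
    using not_summable_harmonic[where 'a = real] summable_Suc_iff[of "\<lambda>n. inverse (real n)"]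
    by (simp add: inverse_eq_divide)
qed

text \<open>The window from \<open>p\<close> to \<open>2 * p - 1\<close> has \<open>p\<close> terms,
  each at least \<open>1 / (2 * p) powr (1 + b)\<close>.\<close>

lemma powr_le_dyadic_sum:
  fixes b :: real
  assumes "b > 0" "p > 0"
  shows "real p powr (-b) \<le> 2 powr (1 + b) * (\<Sum>n\<in>{p..<2*p}. 1 / real n powr (1 + b))"
proof -
  have "real p powr (-b) = 2 powr (1 + b) * (\<Sum>n\<in>{p..<2*p}. 1 / real (2 * p) powr (1 + b))"
    using assms by (simp add: powr_mult powr_add powr_minus field_simps)
  also have "\<dots> \<le> 2 powr (1 + b) * (\<Sum>n\<in>{p..<2*p}. 1 / real n powr (1 + b))"
    using assms by (intro mult_left_mono sum_mono divide_left_mono powr_mono2 mult_pos_pos) auto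
  finally show ?thesis .
qed

text \<open>Each \<open>p\<close> is charged to the \<open>n\<close> in its dyadic window; after
  swapping sums, each \<open>n\<close> is charged by at most \<open>prime_count S n\<close> primes.
  The condition \<open>2 * p \<le> N\<close> makes every window fit.\<close>

lemma sum_powr_le_sum_prime_count:
  fixes b :: real
  assumes "b > 0" "finite F" "F \<subseteq> prime_divisors_of_set S" "\<And>p. p \<in> F \<Longrightarrow> 2 * p \<le> N"
  shows "(\<Sum>p\<in>F. real p powr (-b))
    \<le> 2 powr (1 + b) * (\<Sum>n\<in>{1..N}. real (prime_count S n) / real n powr (1 + b))"
proof -
  let ?v = "\<lambda>n. 1 / real n powr (1 + b)"
  have "(\<Sum>p\<in>F. real p powr (-b)) \<le> (\<Sum>p\<in>F. 2 powr (1 + b) * (\<Sum>n\<in>{1..N}. if p \<le> n then ?v n else 0))"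
  proof (intro sum_mono)
    fix p assume p: "p \<in> F"
    have p0: "p > 0" using p assms(3) by (auto simp: prime_divisors_of_set_def prime_gt_0_nat)
    \<comment> \<open>The indicator of \<open>p \<le> n\<close> allows a range of \<open>n\<close>
      common to all \<open>p\<close>, so that the sums can be swapped.\<close>
    have "(\<Sum>n\<in>{p..<2*p}. ?v n) = (\<Sum>n\<in>{p..<2*p}. if p \<le> n then ?v n else 0)"
      by (intro sum.cong) auto
    also have "\<dots> \<le> (\<Sum>n\<in>{1..N}. if p \<le> n then ?v n else 0)"
      using p0 assms(4)[OF p] by (intro sum_mono2) auto
    finally have "2 powr (1 + b) * (\<Sum>n\<in>{p..<2*p}. ?v n)
        \<le> 2 powr (1 + b) * (\<Sum>n\<in>{1..N}. if p \<le> n then ?v n else 0)"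
      by (intro mult_left_mono) auto
    with powr_le_dyadic_sum[OF assms(1) p0]
    show "real p powr (-b) \<le> 2 powr (1 + b) * (\<Sum>n\<in>{1..N}. if p \<le> n then ?v n else 0)"
      by linarith
  qed
  also have "\<dots> = 2 powr (1 + b) * (\<Sum>n\<in>{1..N}. \<Sum>p\<in>F. if p \<le> n then ?v n else 0)"
    by (subst sum.swap) (simp add: sum_distrib_left)
  also have "\<dots> = 2 powr (1 + b) * (\<Sum>n\<in>{1..N}. real (card {p\<in>F. p \<le> n}) * ?v n)"
    using assms(2) by (simp add: sum.If_cases Int_def)
  also have "\<dots> \<le> 2 powr (1 + b) * (\<Sum>n\<in>{1..N}. real (prime_count S n) * ?v n)"
  proof (intro mult_left_mono sum_mono mult_right_mono)
    fix n
    have "card {p\<in>F. p \<le> n} \<le> prime_count S n"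
      unfolding prime_count_def using assms(3) by (intro card_mono) auto
    then show "real (card {p\<in>F. p \<le> n}) \<le> real (prime_count S n)" by simp
  qed auto
  finally show ?thesis by simp
qed

text \<open>Real-valued form of (b), which also serves the comparison argument for (c).\<close>

lemma not_summable_prime_count:
  assumes "\<alpha> \<ge> 1" "has_poly_density \<alpha> S"
  shows "\<not> summable (\<lambda>n. real (prime_count S (Suc n)) / real (Suc n) powr (1 + 1 / \<alpha>))"
    (is "\<not> summable ?f")
proof
  assume f: "summable ?f"
  obtain F where F: "finite F" "F \<subseteq> prime_divisors_of_set S"
    "(\<Sum>p\<in>F. real p powr (- (1 / \<alpha>))) > 2 powr (1 + 1 / \<alpha>) * suminf ?f"
    using prime_powr_sums_unbounded[OF assms] by blast
  define N where "N = 2 * Max (insert 0 F)"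
  have "(\<Sum>p\<in>F. real p powr (- (1 / \<alpha>)))
      \<le> 2 powr (1 + 1 / \<alpha>) * (\<Sum>n\<in>{1..N}. real (prime_count S n) / real n powr (1 + 1 / \<alpha>))"
    using assms(1) F(1) by (intro sum_powr_le_sum_prime_count F) (auto simp: N_def)
  also have "\<dots> = 2 powr (1 + 1 / \<alpha>) * (\<Sum>n<N. ?f n)"
    by (simp add: sum.atLeast1_atMost_eq)
  also have "\<dots> \<le> 2 powr (1 + 1 / \<alpha>) * suminf ?f"
    using f by (intro mult_left_mono sum_le_suminf) auto
  finally show False using F(3) by simp
qed

theorem theorem1:
  fixes \<alpha> :: real and S :: "nat set"
  assumes "\<alpha> \<ge> 1"
    and "infinite S"
    and "\<forall>s\<in>S. s > 0"
    and "has_poly_density \<alpha> S"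
  shows "(\<Sum>\<^sub>\<infinity>p\<in>prime_divisors_of_set S. ennreal (real p powr (- (1 / \<alpha>)))) = \<infinity> \<and>
    (\<Sum>n. ennreal (real (prime_count S (Suc n)) / real (Suc n) powr (1 + 1 / \<alpha>))) = \<infinity> \<and>
    (\<forall>a :: nat \<Rightarrow> real. (\<forall>n\<ge>1. a n > 0) \<and> summable (\<lambda>n. a (Suc n)) \<longrightarrow>
       infinite {n. n \<ge> 1 \<and> real (prime_count S n) / real n powr (1 + 1 / \<alpha>) \<ge> a n})"
proof (intro conjI allI impI)
  let ?I = "\<Sum>\<^sub>\<infinity>p\<in>prime_divisors_of_set S. ennreal (real p powr (- (1 / \<alpha>)))"
  show "?I = \<infinity>"
  proof (rule ccontr)
    assume "?I \<noteq> \<infinity>"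
    then obtain K where K: "K \<ge> 0" "?I = ennreal K" by (cases ?I) auto
    obtain F where F: "finite F" "F \<subseteq> prime_divisors_of_set S"
      "(\<Sum>p\<in>F. real p powr (- (1 / \<alpha>))) > K"
      using prime_powr_sums_unbounded[OF assms(1,4)] by blast
    \<comment> \<open>A nonnegative infinite sum is the supremum of its finite subsums.\<close>
    have "(\<Sum>p\<in>F. ennreal (real p powr (- (1 / \<alpha>)))) \<le> ?I"
      using F(1,2) by (subst nonneg_infsum_complete) (auto intro!: SUP_upper)
    then have "ennreal (\<Sum>p\<in>F. real p powr (- (1 / \<alpha>))) \<le> ennreal K"
      using K by (simp add: sum_ennreal)
    then show False using F(3) K(1) by (simp add: ennreal_le_iff)
  qed
next
  show "(\<Sum>n. ennreal (real (prime_count S (Suc n)) / real (Suc n) powr (1 + 1 / \<alpha>))) = \<infinity>"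
    using not_summable_prime_count[OF assms(1,4)]
    unfolding infinity_ennreal_def
    by (rule contrapos_np) (rule summable_suminf_not_top; simp)
next
  fix a :: "nat \<Rightarrow> real"
  let ?g = "\<lambda>n. real (prime_count S n) / real n powr (1 + 1 / \<alpha>)"
  assume a: "(\<forall>n\<ge>1. a n > 0) \<and> summable (\<lambda>n. a (Suc n))"
  show "infinite {n. n \<ge> 1 \<and> ?g n \<ge> a n}"
  proof
    assume "finite {n. n \<ge> 1 \<and> ?g n \<ge> a n}"
    then obtain M where M: "\<And>n. n \<ge> 1 \<Longrightarrow> ?g n \<ge> a n \<Longrightarrow> n \<le> M"
      by (auto simp: finite_nat_set_iff_bounded_le)
    \<comment> \<open>Beyond \<open>M\<close> the terms of (b) lie below \<open>a\<close>; already
      \<open>n = M\<close> qualifies, since the index is \<open>Suc n\<close>.\<close>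
    have "norm (?g (Suc n)) \<le> a (Suc n)" if "n \<ge> M" for n
      using M[of "Suc n"] that by fastforce
    then have "summable (\<lambda>n. ?g (Suc n))"
      using a by (intro summable_comparison_test[of "\<lambda>n. ?g (Suc n)" "\<lambda>n. a (Suc n)"]) auto
    then show False using not_summable_prime_count[OF assms(1,4)] by simp
  qed
qed

end
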